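(* Let $f:\mathbb{R}^n\to\mathbb{R}$ be convex and differentiable with $L_f$-Lipschitz gradient, let $g:\mathbb{R}^m\to(-\infty,+\infty]$ be proper, closed and convex (no strong convexity is assumed, i.e. $\mu_f=\mu_g=0$), and let $A\in\mathbb{R}^{m\times n}$. Let $N\ge 1$ be an integer (the maximum iteration number), assume $2L_f+N\|A\|^2>0$, and run $N$ iterations of LDPD (defined in the context) with $$\theta_t=\frac{2}{t+1},\qquad \alpha_t=\frac{t-1}{t},\qquad \tau_t=\frac{t}{N},\qquad \eta_t=\frac{t}{2L_f+N\|A\|^2}.$$ Let $E_{N+1}=L(\bar x_{N+1},y)-L(x,\bar y_{N+1})$, where $$\bar x_{N+1}=\frac{\sum_{t=1}^N t\,x_{t+1}}{\sum_{t=1}^N t},\qquad \bar y_{N+1}=\frac{\sum_{t=1}^N t\,y_{t+1}}{\sum_{t=1}^N t}$$ (these coincide with the LDPD aggregation points). Then for all $x\in\mathbb{R}^n$ and $y\in Y$, $$E_{N+1}\le \frac{2L_f}{N(N+1)}\|x-x_1\|^2+\frac{1}{N+1}\left(\|A\|^2\|x-x_1\|^2+\|y-y_1\|^2\right).$$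
   Context: Saddle point problem: $\min_x\max_y L(x,y)$ with $L(x,y)=f(x)+\langle Ax,y\rangle-g(y)$. Norms are Euclidean, and $\|A\|$ is the operator norm. Put $Y=\operatorname{dom} g=\{y\in\mathbb{R}^m: g(y)<+\infty\}$. LDPD (linearized method): given $x_1\in\mathbb{R}^n$, $y_1\in Y$, parameters $\theta_t\in(0,1]$, $\alpha_t\in\mathbb{R}$, $\tau_t>0$, $\eta_t>0$, set $\bar x_1=x_1$, $\bar y_1=y_1$, $\hat y_1=y_1$, and for $t=1,2,\dots$ compute - $\hat x_t=(1-\theta_t)\bar x_t+\theta_t x_t$, - $x_{t+1}=\arg\min_{x}\|x-[x_t-\eta_t(\nabla f(\hat x_t)+A^T\hat y_t)]\|^2$, - $\bar x_{t+1}=(1-\theta_t)\bar x_t+\theta_t x_{t+1}$, - $y_{t+1}=\arg\min_y\left\{\frac{1}{2\tau_t}\|y-(y_t+\tau_tAx_{t+1})\|^2+g(y)\right\}$, - $\hat y_{t+1}=y_{t+1}+\alpha_{t+1}(y_{t+1}-y_t)$, - $\bar y_{t+1}=(1-\theta_t)\bar y_t+\theta_t y_{t+1}$. *)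

theory Defs
  imports "HOL-Analysis.Analysis"
begin

definition eff_dom :: "('a \<Rightarrow> ereal) \<Rightarrow> 'a set" where
  "eff_dom g = {y. g y < \<infinity>}"

(* As usual for extended-valued functions, the points (y, r) of the epigraph have r real. *)
definition ereal_epigraph :: "('a \<Rightarrow> ereal) \<Rightarrow> ('a \<times> real) set" where
  "ereal_epigraph g = {(y, r). g y \<le> ereal r}"

definition proper_fun :: "('a \<Rightarrow> ereal) \<Rightarrow> bool" where
  "proper_fun g \<longleftrightarrow> (\<forall>y. g y \<noteq> -\<infinity>) \<and> eff_dom g \<noteq> {}"

definition closed_fun :: "('a::topological_space \<Rightarrow> ereal) \<Rightarrow> bool" where
  "closed_fun g \<longleftrightarrow> closed (ereal_epigraph g)"

definition convex_fun :: "('a::real_vector \<Rightarrow> ereal) \<Rightarrow> bool" where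
  "convex_fun g \<longleftrightarrow> convex (ereal_epigraph g)"

(* f + <A., .> - g; for proper g there is never an infinity-minus-infinity here,
   and the value is -\<infinity> outside the effective domain of g. *)
definition saddle_fun ::
  "(real ^ 'n \<Rightarrow> real) \<Rightarrow> real ^ 'n ^ 'm \<Rightarrow> (real ^ 'm \<Rightarrow> ereal) \<Rightarrow> real ^ 'n \<Rightarrow> real ^ 'm \<Rightarrow> ereal" where
  "saddle_fun f A g x y = ereal (f x + (A *v x) \<bullet> y) - g y"

(* The sequences are indexed from 1; their values at 0, and those past what iteration N
   computes, are unconstrained. Df is the gradient map of f. *)
definition LDPD_run ::
  "nat \<Rightarrow> (real ^ 'n \<Rightarrow> real ^ 'n) \<Rightarrow> real ^ 'n ^ 'm \<Rightarrow> (real ^ 'm \<Rightarrow> ereal) \<Rightarrow>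
   (nat \<Rightarrow> real) \<Rightarrow> (nat \<Rightarrow> real) \<Rightarrow> (nat \<Rightarrow> real) \<Rightarrow> (nat \<Rightarrow> real) \<Rightarrow>
   (nat \<Rightarrow> real ^ 'n) \<Rightarrow> (nat \<Rightarrow> real ^ 'n) \<Rightarrow> (nat \<Rightarrow> real ^ 'n) \<Rightarrow>
   (nat \<Rightarrow> real ^ 'm) \<Rightarrow> (nat \<Rightarrow> real ^ 'm) \<Rightarrow> (nat \<Rightarrow> real ^ 'm) \<Rightarrow> bool" where
  "LDPD_run N Df A g \<theta> \<alpha> \<tau> \<eta> xs xhat xbar ys yhat ybar \<longleftrightarrow>
     ys 1 \<in> eff_dom g \<and> xbar 1 = xs 1 \<and> ybar 1 = ys 1 \<and> yhat 1 = ys 1 \<and>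
     (\<forall>t\<in>{1..N}.
        xhat t = (1 - \<theta> t) *\<^sub>R xbar t + \<theta> t *\<^sub>R xs t \<and>
        is_arg_min
          (\<lambda>x. (norm (x - (xs t - \<eta> t *\<^sub>R (Df (xhat t) + transpose A *v yhat t))))\<^sup>2)
          (\<lambda>_. True) (xs (t + 1)) \<and>
        xbar (t + 1) = (1 - \<theta> t) *\<^sub>R xbar t + \<theta> t *\<^sub>R xs (t + 1) \<and>
        is_arg_min
          (\<lambda>y. ereal (1 / (2 * \<tau> t) * (norm (y - (ys t + \<tau> t *\<^sub>R (A *v xs (t + 1)))))\<^sup>2) + g y)
          (\<lambda>_. True) (ys (t + 1)) \<and>
        yhat (t + 1) = ys (t + 1) + \<alpha> (t + 1) *\<^sub>R (ys (t + 1) - ys t) \<and>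
        ybar (t + 1) = (1 - \<theta> t) *\<^sub>R ybar t + \<theta> t *\<^sub>R ys (t + 1))"

definition ergodic_avg :: "nat \<Rightarrow> (nat \<Rightarrow> 'a::real_vector) \<Rightarrow> 'a" where
  "ergodic_avg N z = (\<Sum>t=1..N. real t *\<^sub>R z (t + 1)) /\<^sub>R (\<Sum>t=1..N. real t)"

end

theory Submission
  imports Defs
begin

text \<open>
  The proof exhibits a quantity that never increases along the iteration. Fix a reference point
  \<open>(x, y)\<close> with \<open>y\<close> in the domain of \<open>g\<close>, and write \<open>M\<close> for the operator norm of \<open>A\<close>,
  \<open>K = 2 L\<^sub>f + N M\<^sup>2\<close> and \<open>d\<^sub>k = k (y\<^sub>k\<^sub>+\<^sub>1 - y\<^sub>k)\<close>. After \<open>k\<close> iterations the potential is the gap at the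
  averaged iterates, weighted by \<open>1 + \<dots> + k = k (k + 1) / 2\<close>, plus

    \<open>K/2 |x\<^sub>k\<^sub>+\<^sub>1 - x|\<^sup>2 + N/2 |y\<^sub>k\<^sub>+\<^sub>1 - y|\<^sup>2 + |d\<^sub>k|\<^sup>2 / (2N) - \<langle>A (x\<^sub>k\<^sub>+\<^sub>1 - x), d\<^sub>k\<rangle>\<close>.

  Three estimates feed one step of the iteration. The gradient step is an accelerated one, whose
  error after multiplication by \<open>t (t + 1) / 2\<close> is at most \<open>L\<^sub>f |x\<^sub>t\<^sub>+\<^sub>1 - x\<^sub>t|\<^sup>2\<close>
  (\<open>accelerated_gradient_step\<close>). The optimality condition of the proximal step bounds the values of
  \<open>g\<close> (\<open>prox_variational_inequality\<close>). The step sizes are such that \<open>t / \<eta>\<^sub>t = K\<close> and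
  \<open>t / \<tau>\<^sub>t = N\<close> do not depend on \<open>t\<close>, so the distances to the reference point telescope.

  Write \<open>z\<^sub>t\<close> for the extrapolated dual point used in iteration \<open>t\<close>. What is left of the bilinear
  part is \<open>t \<langle>A (x\<^sub>t\<^sub>+\<^sub>1 - x), y\<^sub>t\<^sub>+\<^sub>1 - z\<^sub>t\<rangle>\<close>. Since \<open>t \<alpha>\<^sub>t = t - 1\<close>, the
  extrapolation gives \<open>t (y\<^sub>t\<^sub>+\<^sub>1 - z\<^sub>t) = d\<^sub>t - d\<^sub>t\<^sub>-\<^sub>1\<close>. Hence this term telescopes as well, up to
  \<open>\<langle>A (x\<^sub>t\<^sub>+\<^sub>1 - x\<^sub>t), d\<^sub>t\<^sub>-\<^sub>1\<rangle>\<close>. Young's inequality (\<open>bilinear_young\<close>) splits that error into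
  \<open>N/2 M\<^sup>2 |x\<^sub>t\<^sub>+\<^sub>1 - x\<^sub>t|\<^sup>2\<close> and \<open>|d\<^sub>t\<^sub>-\<^sub>1|\<^sup>2 / (2N)\<close>. The first part and the gradient error are together
  exactly the decrease \<open>K/2 |x\<^sub>t\<^sub>+\<^sub>1 - x\<^sub>t|\<^sup>2\<close> supplied by the primal step; the second is stored in
  the previous potential. The new \<open>|d\<^sub>t|\<^sup>2 / (2N)\<close> is paid for by the dual decrease
  \<open>N/2 |y\<^sub>t\<^sub>+\<^sub>1 - y\<^sub>t|\<^sup>2\<close>, because \<open>t \<le> N\<close>. This is \<open>potential_step\<close>.

  In the final potential the terms other than the gap have a nonnegative sum, again by Young's
  inequality, and the initial potential is \<open>K/2 |x\<^sub>1 - x|\<^sup>2 + N/2 |y\<^sub>1 - y|\<^sup>2\<close>. Dividing by \<open>N (N + 1) / 2\<close> gives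
  the rate.
\<close>

section \<open>Smooth convex functions\<close>

lemma gderiv_has_derivative_along_line:
  fixes f :: "'a::real_inner \<Rightarrow> real"
  assumes "\<And>x. GDERIV f x :> Df x"
  shows "((\<lambda>s. f (x + s *\<^sub>R v)) has_real_derivative Df (x + s *\<^sub>R v) \<bullet> v) (at s within S)"
proof -
  have f: "(f has_derivative (\<lambda>h. h \<bullet> Df (x + s *\<^sub>R v))) (at (x + s *\<^sub>R v))"
    using assms by (simp add: gderiv_def)
  have l: "((\<lambda>s. x + s *\<^sub>R v) has_derivative (\<lambda>r. r *\<^sub>R v)) (at s within S)"
    by (auto intro!: derivative_eq_intros)
  have "((\<lambda>s. f (x + s *\<^sub>R v)) has_derivative (\<lambda>r. (r *\<^sub>R v) \<bullet> Df (x + s *\<^sub>R v))) (at s within S)"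
    by (rule has_derivative_compose[OF l f])
  then show ?thesis
    by (simp add: has_field_derivative_def inner_commute mult_commute_abs)
qed

text \<open>Both first-order bounds on \<open>f\<close> below come from restricting it to the segment from \<open>x\<close> to
  \<open>z\<close>, where one-variable calculus applies.\<close>

lemma convex_gderiv_above_tangent:
  fixes f :: "'a::real_inner \<Rightarrow> real"
  assumes "convex_on UNIV f" and "\<And>x. GDERIV f x :> Df x"
  shows "f x + Df x \<bullet> (z - x) \<le> f z"
proof -
  let ?p = "\<lambda>s. f (x + s *\<^sub>R (z - x))"
  have "convex_on UNIV ?p"
  proof (rule convex_onI)
    fix t a b :: real
    assume t: "0 < t" "t < 1"
    have "x + ((1 - t) *\<^sub>R a + t *\<^sub>R b) *\<^sub>R (z - x)
        = (1 - t) *\<^sub>R (x + a *\<^sub>R (z - x)) + t *\<^sub>R (x + b *\<^sub>R (z - x))"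
      by (simp add: algebra_simps)
    then show "?p ((1 - t) *\<^sub>R a + t *\<^sub>R b) \<le> (1 - t) * ?p a + t * ?p b"
      using convex_onD[OF assms(1), of t "x + a *\<^sub>R (z - x)" "x + b *\<^sub>R (z - x)"] t by simp
  qed simp
  moreover have "(?p has_real_derivative Df x \<bullet> (z - x)) (at 0)"
    using gderiv_has_derivative_along_line[OF assms(2), where s = 0 and x = x and v = "z - x"] by simp
  ultimately have "?p 1 - ?p 0 \<ge> (Df x \<bullet> (z - x)) * (1 - 0)"
    by (intro convex_on_imp_above_tangent) auto
  then show ?thesis by simp
qed

lemma lipschitz_gradient_upper_bound:
  fixes f :: "'a::real_inner \<Rightarrow> real"
  assumes df: "\<And>x. GDERIV f x :> Df x" and lip: "L-lipschitz_on UNIV Df"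
  shows "f z \<le> f x + Df x \<bullet> (z - x) + L / 2 * (norm (z - x))\<^sup>2"
proof -
  define v where "v = z - x"
  \<comment> \<open>The claimed bound compares the endpoints of this function, whose slope is nonpositive by
    Cauchy-Schwarz and the Lipschitz condition.\<close>
  let ?p = "\<lambda>s. f (x + s *\<^sub>R v) - s * (Df x \<bullet> v) - L / 2 * s\<^sup>2 * (norm v)\<^sup>2"
  have "?p 1 \<le> ?p 0"
  proof (rule DERIV_nonpos_imp_nonincreasing[where f = ?p])
    fix s :: real
    assume s: "0 \<le> s" "s \<le> 1"
    have "(?p has_real_derivative (Df (x + s *\<^sub>R v) \<bullet> v - Df x \<bullet> v - L * s * (norm v)\<^sup>2)) (at s)"
      by (auto intro!: derivative_eq_intros gderiv_has_derivative_along_line[OF df])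
    moreover have "Df (x + s *\<^sub>R v) \<bullet> v - Df x \<bullet> v \<le> L * s * (norm v)\<^sup>2"
    proof -
      have "(Df (x + s *\<^sub>R v) - Df x) \<bullet> v \<le> norm (Df (x + s *\<^sub>R v) - Df x) * norm v"
        by (rule norm_cauchy_schwarz)
      also have "\<dots> \<le> L * (s * norm v) * norm v"
        using lipschitz_onD[OF lip, of "x + s *\<^sub>R v" x] s
        by (intro mult_right_mono) (auto simp: dist_norm)
      finally show ?thesis by (simp add: inner_diff_left power2_eq_square mult_ac)
    qed
    ultimately show "\<exists>y. (?p has_real_derivative y) (at s) \<and> y \<le> 0" by force
  qed simp
  then show ?thesis by (simp add: v_def)
qed

text \<open>The gradient is taken at \<open>w\<close>, which differs from the new average \<open>u'\<close> only by
  \<open>\<theta> (p' - p)\<close>; so the quadratic error carries \<open>\<theta>\<^sup>2\<close>, not \<open>\<theta>\<close>, and this is what makes the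
  \<open>L\<^sub>f\<close> part of the rate quadratic in \<open>1/N\<close>. The linear part at \<open>u'\<close> is a convex combination of the
  tangent bounds at \<open>u\<close> and \<open>x\<close>, with the remainder \<open>p' - x\<close> left for the primal update to
  absorb.\<close>

lemma accelerated_gradient_step:
  fixes f :: "'a::real_inner \<Rightarrow> real"
  assumes cvx: "convex_on UNIV f" and df: "\<And>x. GDERIV f x :> Df x"
    and lip: "L-lipschitz_on UNIV Df"
    and \<theta>: "0 \<le> \<theta>" "\<theta> \<le> 1"
    and w: "w = (1 - \<theta>) *\<^sub>R u + \<theta> *\<^sub>R p" and u': "u' = (1 - \<theta>) *\<^sub>R u + \<theta> *\<^sub>R p'"
  shows "f u' \<le> (1 - \<theta>) * f u + \<theta> * (f x + Df w \<bullet> (p' - x)) + L / 2 * \<theta>\<^sup>2 * (norm (p' - p))\<^sup>2"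
proof -
  have "u' - w = \<theta> *\<^sub>R (p' - p)" by (simp add: w u' algebra_simps)
  then have n: "(norm (u' - w))\<^sup>2 = \<theta>\<^sup>2 * (norm (p' - p))\<^sup>2" by (simp add: power_mult_distrib)
  have "u' - w = (1 - \<theta>) *\<^sub>R (u - w) + \<theta> *\<^sub>R ((x - w) + (p' - x))"
    by (simp add: u' algebra_simps)
  then have "Df w \<bullet> (u' - w) = (1 - \<theta>) * (Df w \<bullet> (u - w))
      + \<theta> * (Df w \<bullet> (x - w) + Df w \<bullet> (p' - x))"
    by (simp only: inner_add_right inner_scaleR_right)
  then have "f w + Df w \<bullet> (u' - w) = (1 - \<theta>) * (f w + Df w \<bullet> (u - w))
      + \<theta> * (f w + Df w \<bullet> (x - w)) + \<theta> * (Df w \<bullet> (p' - x))"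
    by algebra
  also have "\<dots> \<le> (1 - \<theta>) * f u + \<theta> * f x + \<theta> * (Df w \<bullet> (p' - x))"
    using \<theta> by (intro add_mono mult_left_mono convex_gderiv_above_tangent[OF cvx df]) auto
  finally show ?thesis
    using lipschitz_gradient_upper_bound[OF df lip, of u' w] n by (simp add: algebra_simps)
qed

section \<open>Proper convex functions and the proximal step\<close>

lemma proper_fun_eq_ereal_real:
  assumes "proper_fun g" "y \<in> eff_dom g"
  shows "g y = ereal (real_of_ereal (g y))"
  using assms by (cases "g y") (auto simp: proper_fun_def eff_dom_def)

lemma proper_convex_fun_imp_convex_on:
  assumes p: "proper_fun g" and c: "convex_fun g"
  shows "convex_on (eff_dom g) (\<lambda>y. real_of_ereal (g y))"
proof -
  let ?h = "\<lambda>y. real_of_ereal (g y)"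
  note fin = proper_fun_eq_ereal_real[OF p]
  have J: "g ((1 - t) *\<^sub>R a + t *\<^sub>R b) \<le> ereal ((1 - t) * ?h a + t * ?h b)"
    if "a \<in> eff_dom g" "b \<in> eff_dom g" "0 \<le> t" "t \<le> 1" for a b t
  proof -
    have "(a, ?h a) \<in> ereal_epigraph g" "(b, ?h b) \<in> ereal_epigraph g"
      using fin that by (auto simp: ereal_epigraph_def)
    then have "(1 - t) *\<^sub>R (a, ?h a) + t *\<^sub>R (b, ?h b) \<in> ereal_epigraph g"
      using c that by (intro convexD) (auto simp: convex_fun_def)
    then show ?thesis by (simp add: ereal_epigraph_def)
  qed
  have D: "(1 - t) *\<^sub>R a + t *\<^sub>R b \<in> eff_dom g"
    if "a \<in> eff_dom g" "b \<in> eff_dom g" "0 \<le> t" "t \<le> 1" for a b t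
    using J[OF that] by (auto simp: eff_dom_def intro: le_less_trans)
  show ?thesis
  proof (rule convex_onI)
    fix t :: real and a b
    assume t: "0 < t" "t < 1" and ab: "a \<in> eff_dom g" "b \<in> eff_dom g"
    show "?h ((1 - t) *\<^sub>R a + t *\<^sub>R b) \<le> (1 - t) * ?h a + t * ?h b"
      using J[OF ab, of t] fin[OF D[OF ab, of t]] t by (metis ereal_less_eq(3) less_imp_le)
  next
    show "convex (eff_dom g)" unfolding convex_alt using D by auto
  qed
qed

lemma prox_in_eff_dom:
  assumes p: "proper_fun g"
    and m: "is_arg_min (\<lambda>y. ereal (q y) + g y) (\<lambda>_. True) z"
  shows "z \<in> eff_dom g"
proof (rule ccontr)
  assume "z \<notin> eff_dom g"
  moreover obtain w where w: "w \<in> eff_dom g" using p by (auto simp: proper_fun_def)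
  ultimately have "ereal (q w) + g w < ereal (q z) + g z"
    using proper_fun_eq_ereal_real[OF p w] by (cases "g w") (auto simp: eff_dom_def)
  then show False using m by (auto simp: is_arg_min_def)
qed

text \<open>The first-order optimality condition of the proximal point, obtained without subgradients:
  comparing \<open>z\<close> with points slightly towards \<open>y\<close> gives the inequality up to an error
  proportional to the displacement \<open>s\<close>, and \<open>s\<close> tends to \<open>0\<close>.\<close>

lemma prox_variational_inequality:
  fixes g :: "'a::real_inner \<Rightarrow> ereal"
  assumes p: "proper_fun g" and c: "convex_fun g" and \<tau>: "\<tau> > 0"
    and m: "is_arg_min (\<lambda>y. ereal (1 / (2 * \<tau>) * (norm (y - c0))\<^sup>2) + g y) (\<lambda>_. True) z"
    and y: "y \<in> eff_dom g"
  shows "real_of_ereal (g z) - real_of_ereal (g y) \<le> (1 / \<tau>) * ((c0 - z) \<bullet> (z - y))"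
proof -
  let ?h = "\<lambda>y. real_of_ereal (g y)"
  note z = prox_in_eff_dom[OF p m]
  note cvx = proper_convex_fun_imp_convex_on[OF p c]
  note fin = proper_fun_eq_ereal_real[OF p]
  define B where "B = 1 / (2 * \<tau>) * (norm (y - z))\<^sup>2"
  define a where "a = ?h z - ?h y - (1 / \<tau>) * ((c0 - z) \<bullet> (z - y))"
  have s: "a \<le> s * B" if s: "0 < s" "s < 1" for s
  proof -
    let ?w = "(1 - s) *\<^sub>R z + s *\<^sub>R y"
    have w: "?w \<in> eff_dom g"
      using convex_on_imp_convex[OF cvx] z y s by (intro convexD) auto
    have "\<not> ereal (1 / (2 * \<tau>) * (norm (?w - c0))\<^sup>2) + g ?w
        < ereal (1 / (2 * \<tau>) * (norm (z - c0))\<^sup>2) + g z"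
      using m by (auto simp: is_arg_min_def)
    then have "1 / (2 * \<tau>) * (norm (z - c0))\<^sup>2 + ?h z \<le> 1 / (2 * \<tau>) * (norm (?w - c0))\<^sup>2 + ?h ?w"
      by (subst (asm) (1 2) fin) (use z w in \<open>auto\<close>)
    also have "?h ?w \<le> (1 - s) * ?h z + s * ?h y"
      using convex_onD[OF cvx] z y s by simp
    also have "(norm (?w - c0))\<^sup>2
        = (norm (z - c0))\<^sup>2 + 2 * s * ((c0 - z) \<bullet> (z - y)) + s\<^sup>2 * (norm (y - z))\<^sup>2"
    proof -
      have "?w - c0 = (z - c0) + s *\<^sub>R (y - z)" by (simp add: algebra_simps)
      moreover have "(norm ((z - c0) + s *\<^sub>R (y - z)))\<^sup>2
          = (norm (z - c0))\<^sup>2 + 2 * s * ((z - c0) \<bullet> (y - z)) + s\<^sup>2 * (norm (y - z))\<^sup>2"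
        using dot_norm[of "z - c0" "s *\<^sub>R (y - z)"] by (simp add: power_mult_distrib)
      moreover have "(z - c0) \<bullet> (y - z) = (c0 - z) \<bullet> (z - y)"
        by (metis inner_minus_left inner_minus_right minus_diff_eq minus_minus)
      ultimately show ?thesis by (simp only:)
    qed
    finally have "s * a \<le> s * (s * B)"
      using \<tau> by (simp add: a_def B_def field_simps power2_eq_square)
    then show ?thesis using s by simp
  qed
  have "((\<lambda>s. s * B) \<longlongrightarrow> 0 * B) (at_right 0)"
    by (intro tendsto_intros)
  moreover have "eventually (\<lambda>s. a \<le> s * B) (at_right 0)"
    using eventually_at_right_real[of 0 1] by (rule eventually_mono) (use s in auto)
  ultimately have "a \<le> 0 * B"
    by (intro tendsto_lowerbound) auto
  then show ?thesis by (simp add: a_def)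
qed

section \<open>Weighted averages\<close>

lemma sum_real_upto: "(\<Sum>t=1..N. real t) = real N * (real N + 1) / 2"
  by (induction N) (auto simp: field_simps)

text \<open>This form shows why the averages are the \<open>t\<close>-weighted means: multiplied by the partial sum \<open>1 + \<dots> + t\<close>, the rule with
  \<open>\<theta>\<^sub>t = 2 / (t + 1)\<close> merely adds the new point with weight \<open>t\<close>. At \<open>t = 1\<close> the old average has
  weight \<open>0\<close>, so the starting point is forgotten.\<close>

lemma averaging_step_rescaled:
  fixes u p :: "'a::real_vector"
  assumes "u' = (1 - 2 / (real t + 1)) *\<^sub>R u + (2 / (real t + 1)) *\<^sub>R p"
  shows "(real t * (real t + 1) / 2) *\<^sub>R u' = (real t * (real t - 1) / 2) *\<^sub>R u + real t *\<^sub>R p"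
proof -
  have "real t * (real t + 1) / 2 * (1 - 2 / (real t + 1)) = real t * (real t - 1) / 2"
    "real t * (real t + 1) / 2 * (2 / (real t + 1)) = real t"
    by (simp_all add: field_simps)
  then show ?thesis unfolding assms scaleR_add_right scaleR_scaleR by simp
qed

lemma averaging_recursion_eq_ergodic_avg:
  fixes z zbar :: "nat \<Rightarrow> 'a::real_vector"
  assumes N: "N \<ge> 1"
    and rec: "\<And>t. t \<in> {1..N} \<Longrightarrow>
      zbar (t + 1) = (1 - 2 / (real t + 1)) *\<^sub>R zbar t + (2 / (real t + 1)) *\<^sub>R z (t + 1)"
  shows "zbar (N + 1) = ergodic_avg N z"
proof -
  have "(real k * (real k + 1) / 2) *\<^sub>R zbar (k + 1) = (\<Sum>t=1..k. real t *\<^sub>R z (t + 1))"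
    if "k \<le> N" for k
    using that
  proof (induction k)
    case (Suc k)
    then show ?case
      using averaging_step_rescaled[OF rec, of "Suc k"] by (simp add: algebra_simps)
  qed simp
  then have "(real N * (real N + 1) / 2) *\<^sub>R zbar (N + 1) = (\<Sum>t=1..N. real t *\<^sub>R z (t + 1))"
    by simp
  moreover have "real N * (real N + 1) / 2 \<noteq> 0" using N by simp
  ultimately show ?thesis
    unfolding ergodic_avg_def sum_real_upto
    by (metis (no_types, lifting) scaleR_scaleR left_inverse scaleR_one)
qed

section \<open>The primal-dual potential\<close>

lemma three_point_identity:
  fixes a b c :: "'a::real_inner"
  shows "2 * ((a - b) \<bullet> (b - c)) = (norm (a - c))\<^sup>2 - (norm (b - c))\<^sup>2 - (norm (b - a))\<^sup>2"
  by (simp add: power2_norm_eq_inner inner_diff inner_commute algebra_simps)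

lemma bilinear_young:
  fixes A :: "real ^ 'n ^ 'm"
  assumes "c > 0"
  shows "\<bar>(A *v u) \<bullet> d\<bar> \<le> c / 2 * (onorm ((*v) A))\<^sup>2 * (norm u)\<^sup>2 + (norm d)\<^sup>2 / (2 * c)"
proof -
  let ?M = "onorm ((*v) A)"
  have "\<bar>(A *v u) \<bullet> d\<bar> \<le> norm (A *v u) * norm d"
    by (rule Cauchy_Schwarz_ineq2)
  also have "\<dots> \<le> (?M * norm u) * norm d"
    by (intro mult_right_mono onorm) (auto simp: matrix_vector_mul_bounded_linear)
  also have "\<dots> \<le> c / 2 * (?M * norm u)\<^sup>2 + (norm d)\<^sup>2 / (2 * c)"
  proof -
    have "0 \<le> (c * (?M * norm u) - norm d)\<^sup>2" by simp
    then have "2 * c * ((?M * norm u) * norm d) \<le> c\<^sup>2 * (?M * norm u)\<^sup>2 + (norm d)\<^sup>2"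
      by (simp add: power2_diff power_mult_distrib algebra_simps)
    then show ?thesis using assms by (simp add: field_simps power2_eq_square)
  qed
  finally show ?thesis by (simp add: power_mult_distrib algebra_simps)
qed

text \<open>The saddle gap of \<open>(u, v)\<close> against a fixed reference point \<open>(x, y)\<close>, with a real-valued
  \<open>h\<close> standing for \<open>g\<close> on its domain so that all estimates are real arithmetic.\<close>

definition reference_gap ::
  "(real ^ 'n \<Rightarrow> real) \<Rightarrow> real ^ 'n ^ 'm \<Rightarrow> (real ^ 'm \<Rightarrow> real) \<Rightarrow> real ^ 'n \<Rightarrow> real ^ 'm
    \<Rightarrow> real ^ 'n \<Rightarrow> real ^ 'm \<Rightarrow> real" where
  "reference_gap f A h x y u v = (f u + (A *v u) \<bullet> y - h y) - (f x + (A *v x) \<bullet> v - h v)"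

text \<open>The weighted squared distances of \<open>(p, q)\<close> to the reference point, together with a memory of
  the last scaled dual displacement \<open>d\<close>. Keeping \<open>d\<close> as an argument, instead of two consecutive
  dual iterates, lets the iteration start from \<open>d = 0\<close> without a fictitious dual iterate
  before the first.\<close>

definition distance_potential ::
  "real \<Rightarrow> real \<Rightarrow> real ^ 'n ^ 'm \<Rightarrow> real ^ 'n \<Rightarrow> real ^ 'm \<Rightarrow> real ^ 'n \<Rightarrow> real ^ 'm \<Rightarrow> real ^ 'm \<Rightarrow> real" where
  "distance_potential K c A x y p q d =
     K / 2 * (norm (p - x))\<^sup>2 + c / 2 * (norm (q - y))\<^sup>2
     + (norm d)\<^sup>2 / (2 * c) - (A *v (p - x)) \<bullet> d"

text \<open>The cross term is the only negative one; it is dominated by the \<open>c M\<^sup>2\<close> share of the primal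
  distance and the stored displacement, with \<open>M\<close> the operator norm of \<open>A\<close>.\<close>

lemma distance_potential_nonneg:
  assumes "c > 0" "K \<ge> c * (onorm ((*v) A))\<^sup>2"
  shows "0 \<le> distance_potential K c A x y p q d"
proof -
  have "c / 2 * (onorm ((*v) A))\<^sup>2 * (norm (p - x))\<^sup>2 \<le> K / 2 * (norm (p - x))\<^sup>2"
    using assms by (intro mult_right_mono) auto
  moreover have "0 \<le> c / 2 * (norm (q - y))\<^sup>2" using assms by simp
  ultimately show ?thesis
    using bilinear_young[OF assms(1), of A "p - x" d] unfolding distance_potential_def by linarith
qed

text \<open>One iteration does not increase the potential. Unprimed letters are the state before the
  iteration and primed ones the state after it: \<open>u\<close>, \<open>v\<close> are the averages, \<open>p\<close>, \<open>q\<close> the iterates,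
  \<open>d\<close> the scaled dual displacement, \<open>r\<close> the extrapolated dual point and \<open>\<phi>\<close> the gradient used.
  The two updates and the extrapolation enter as the hypotheses \<open>P\<close>, \<open>Q\<close> and \<open>r\<close>, already
  multiplied by the weight \<open>t\<close>: in this form the step sizes have become the constants \<open>K\<close> and
  \<open>c\<close>, where \<open>c\<close> is the number of iterations.\<close>

lemma potential_step:
  fixes A :: "real ^ 'n ^ 'm"
  assumes c: "0 < c" and t: "0 \<le> t" "t \<le> c" and L: "0 \<le> L"
    and K: "K = 2 * L + c * (onorm ((*v) A))\<^sup>2"
    and F: "S' * f u' \<le> S * f u + t * (f x + \<phi> \<bullet> (p' - x)) + L * (norm (p' - p))\<^sup>2"
    and P: "t *\<^sub>R (\<phi> + transpose A *v r) = K *\<^sub>R (p - p')"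
    and H: "S' * h v' \<le> S * h v + t * h q'"
    and Q: "t * (h q' - h y) \<le> (c *\<^sub>R (q - q') + t *\<^sub>R (A *v p')) \<bullet> (q' - y)"
    and r: "t *\<^sub>R r = t *\<^sub>R q + d"
    and u: "S' *\<^sub>R u' = S *\<^sub>R u + t *\<^sub>R p'" and v: "S' *\<^sub>R v' = S *\<^sub>R v + t *\<^sub>R q'"
    and S: "S' = S + t"
  shows "S' * reference_gap f A h x y u' v' + distance_potential K c A x y p' q' (t *\<^sub>R (q' - q))
       \<le> S * reference_gap f A h x y u v + distance_potential K c A x y p q d"
proof -
  let ?M = "onorm ((*v) A)"
  have gap: "S' * reference_gap f A h x y u' v'
    \<le> S * reference_gap f A h x y u v + t * (\<phi> \<bullet> (p' - x)) + L * (norm (p' - p))\<^sup>2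
      + t * (h q' - h y) + t * ((A *v p') \<bullet> y) - t * ((A *v x) \<bullet> q')"
  proof -
    have a: "S' * ((A *v u') \<bullet> y) = S * ((A *v u) \<bullet> y) + t * ((A *v p') \<bullet> y)"
      using arg_cong[OF u, of "\<lambda>w. (A *v w) \<bullet> y"]
      by (simp add: matrix_vector_right_distrib matrix_vector_mult_scaleR inner_add_left)
    have b: "S' * ((A *v x) \<bullet> v') = S * ((A *v x) \<bullet> v) + t * ((A *v x) \<bullet> q')"
      using arg_cong[OF v, of "\<lambda>w. (A *v x) \<bullet> w"] by (simp add: inner_add_right)
    have "S' * reference_gap f A h x y u' v' = S' * f u' + S' * ((A *v u') \<bullet> y) - S' * h y
        - S' * f x - S' * ((A *v x) \<bullet> v') + S' * h v'"
      by (simp add: reference_gap_def algebra_simps)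
    moreover have "S * reference_gap f A h x y u v = S * f u + S * ((A *v u) \<bullet> y) - S * h y
        - S * f x - S * ((A *v x) \<bullet> v) + S * h v"
      by (simp add: reference_gap_def algebra_simps)
    moreover have "S' * f x = S * f x + t * f x" "S' * h y = S * h y + t * h y"
      by (simp_all add: S algebra_simps)
    ultimately show ?thesis using a b F H by (simp add: algebra_simps)
  qed
  have primal: "t * (\<phi> \<bullet> (p' - x)) = K * ((p - p') \<bullet> (p' - x)) - t * ((A *v (p' - x)) \<bullet> r)"
  proof -
    have "(transpose A *v r) \<bullet> (p' - x) = (A *v (p' - x)) \<bullet> r"
      by (simp only: transpose_matrix_vector dot_lmul_matrix inner_commute)
    then show ?thesis
      using arg_cong[OF P, of "\<lambda>w. w \<bullet> (p' - x)"]
      by (simp only: inner_add_left inner_scaleR_left distrib_left)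
  qed
  have cross: "t * ((A *v (p' - x)) \<bullet> r) = t * ((A *v (p' - x)) \<bullet> q) + (A *v (p' - x)) \<bullet> d"
    using arg_cong[OF r, of "\<lambda>w. (A *v (p' - x)) \<bullet> w"] by (simp add: inner_add_right)
  have young: "- ((A *v (p' - p)) \<bullet> d)
      \<le> c / 2 * ?M\<^sup>2 * (norm (p' - p))\<^sup>2 + (norm d)\<^sup>2 / (2 * c)"
    using bilinear_young[OF c, of A "p' - p" d] by linarith
  have dual: "(norm (t *\<^sub>R (q' - q)))\<^sup>2 / (2 * c) \<le> c / 2 * (norm (q' - q))\<^sup>2"
  proof -
    have "t\<^sup>2 \<le> c\<^sup>2" using t by (intro power_mono) auto
    then have "t\<^sup>2 * (norm (q' - q))\<^sup>2 \<le> c\<^sup>2 * (norm (q' - q))\<^sup>2" by (intro mult_right_mono) auto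
    then have "(norm (t *\<^sub>R (q' - q)))\<^sup>2 \<le> c\<^sup>2 * (norm (q' - q))\<^sup>2"
      by (simp only: norm_scaleR power_mult_distrib power2_abs)
    then show ?thesis using c by (simp add: field_simps power2_eq_square)
  qed
  have x3: "K * ((p - p') \<bullet> (p' - x)) = K / 2 * (norm (p - x))\<^sup>2 - K / 2 * (norm (p' - x))\<^sup>2
      - (L * (norm (p' - p))\<^sup>2 + c / 2 * ?M\<^sup>2 * (norm (p' - p))\<^sup>2)"
  proof -
    have "K * ((p - p') \<bullet> (p' - x)) = K / 2 * (2 * ((p - p') \<bullet> (p' - x)))" by simp
    also have "\<dots> = K / 2 * (norm (p - x))\<^sup>2 - K / 2 * (norm (p' - x))\<^sup>2 - K / 2 * (norm (p' - p))\<^sup>2"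
      by (simp only: three_point_identity right_diff_distrib)
    also have "K / 2 * (norm (p' - p))\<^sup>2 = L * (norm (p' - p))\<^sup>2 + c / 2 * ?M\<^sup>2 * (norm (p' - p))\<^sup>2"
      by (simp add: K field_simps)
    finally show ?thesis .
  qed
  have y3: "c * ((q - q') \<bullet> (q' - y)) = c / 2 * (norm (q - y))\<^sup>2 - c / 2 * (norm (q' - y))\<^sup>2
      - c / 2 * (norm (q' - q))\<^sup>2"
    using arg_cong[OF three_point_identity[of q q' y], of "\<lambda>w. c / 2 * w"]
    by (simp add: right_diff_distrib)
  have Q': "t * (h q' - h y) \<le> c * ((q - q') \<bullet> (q' - y)) + t * ((A *v p') \<bullet> (q' - y))"
    using Q by (simp add: inner_add_left)
  \<comment> \<open>The bilinear contributions of the gap, the dual step and the extrapolation collapse to the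
    new cross term of the potential.\<close>
  have bil: "t * ((A *v p') \<bullet> (q' - y)) + t * ((A *v p') \<bullet> y) - t * ((A *v x) \<bullet> q')
      - t * ((A *v (p' - x)) \<bullet> q) = (A *v (p' - x)) \<bullet> (t *\<^sub>R (q' - q))"
    by (simp add: matrix_vector_mult_diff_distrib inner_diff algebra_simps)
  \<comment> \<open>The old cross term is about \<open>p\<close>, not \<open>p'\<close>; the discrepancy is what \<open>young\<close> pays for.\<close>
  have spl: "(A *v (p' - x)) \<bullet> d = (A *v (p' - p)) \<bullet> d + (A *v (p - x)) \<bullet> d"
    by (simp add: matrix_vector_mult_diff_distrib inner_diff)
  show ?thesis
    unfolding distance_potential_def
    using gap primal cross young dual x3 y3 Q' bil spl by linarith
qed

section \<open>Ergodic convergence\<close>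

theorem theorem3p1:
  fixes f :: "real ^ 'n \<Rightarrow> real" and Df :: "real ^ 'n \<Rightarrow> real ^ 'n"
    and g :: "real ^ 'm \<Rightarrow> ereal"
    and A :: "real ^ 'n ^ 'm"
    and Lf :: real and N :: nat
    and xs xhat xbar :: "nat \<Rightarrow> real ^ 'n"
    and ys yhat ybar :: "nat \<Rightarrow> real ^ 'm"
  assumes "convex_on UNIV f"
    and "\<And>x. GDERIV f x :> Df x"
    and "Lf-lipschitz_on UNIV Df"
    and "proper_fun g" and "closed_fun g" and "convex_fun g"
    and "N \<ge> 1"
    and "2 * Lf + real N * (onorm ((*v) A))\<^sup>2 > 0"
    and "LDPD_run N Df A g
           (\<lambda>t. 2 / (real t + 1))
           (\<lambda>t. (real t - 1) / real t)
           (\<lambda>t. real t / real N)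
           (\<lambda>t. real t / (2 * Lf + real N * (onorm ((*v) A))\<^sup>2))
           xs xhat xbar ys yhat ybar"
  shows "xbar (N + 1) = ergodic_avg N xs \<and> ybar (N + 1) = ergodic_avg N ys \<and>
    (\<forall>x. \<forall>y\<in>eff_dom g.
       saddle_fun f A g (ergodic_avg N xs) y - saddle_fun f A g x (ergodic_avg N ys)
       \<le> ereal (2 * Lf / (real N * (real N + 1)) * (norm (x - xs 1))\<^sup>2
           + 1 / (real N + 1) * ((onorm ((*v) A))\<^sup>2 * (norm (x - xs 1))\<^sup>2 + (norm (y - ys 1))\<^sup>2)))"
proof -
  define M where "M = onorm ((*v) A)"
  define K where "K = 2 * Lf + real N * M\<^sup>2"
  define h where "h = (\<lambda>y. real_of_ereal (g y))"
  have K0: "K > 0" using assms(8) by (simp add: K_def M_def)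
  have N0: "real N > 0" using assms(7) by simp
  have L0: "Lf \<ge> 0" using lipschitz_on_nonneg[OF assms(3)] .
  have KM: "K = 2 * Lf + real N * (onorm ((*v) A))\<^sup>2" by (simp add: K_def M_def)
  note run = assms(9)[unfolded LDPD_run_def, folded KM]
  have init: "ys 1 \<in> eff_dom g" "xbar 1 = xs 1" "ybar 1 = ys 1" "yhat 1 = ys 1"
    using run by auto
  have xhat: "xhat t = (1 - 2 / (real t + 1)) *\<^sub>R xbar t + (2 / (real t + 1)) *\<^sub>R xs t"
    and xbar: "xbar (t + 1) = (1 - 2 / (real t + 1)) *\<^sub>R xbar t + (2 / (real t + 1)) *\<^sub>R xs (t + 1)"
    and ybar: "ybar (t + 1) = (1 - 2 / (real t + 1)) *\<^sub>R ybar t + (2 / (real t + 1)) *\<^sub>R ys (t + 1)"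
    and yhat: "yhat (t + 1) = ys (t + 1) + ((real (t + 1) - 1) / real (t + 1)) *\<^sub>R (ys (t + 1) - ys t)"
    and xmin: "is_arg_min
          (\<lambda>x. (norm (x - (xs t - (real t / K) *\<^sub>R (Df (xhat t) + transpose A *v yhat t))))\<^sup>2)
          (\<lambda>_. True) (xs (t + 1))"
    and ymin: "is_arg_min (\<lambda>y. ereal (1 / (2 * (real t / real N)) *
            (norm (y - (ys t + (real t / real N) *\<^sub>R (A *v xs (t + 1)))))\<^sup>2) + g y)
          (\<lambda>_. True) (ys (t + 1))"
    if "t \<in> {1..N}" for t
    using run that by blast+
  have ex: "xbar (N + 1) = ergodic_avg N xs"
    using averaging_recursion_eq_ergodic_avg[OF assms(7) xbar] .
  have ey: "ybar (N + 1) = ergodic_avg N ys"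
    using averaging_recursion_eq_ergodic_avg[OF assms(7) ybar] .
  note cvx = proper_convex_fun_imp_convex_on[OF assms(4,6), folded h_def]
  have ysD: "ys (t + 1) \<in> eff_dom g" if "t \<in> {1..N}" for t
    using prox_in_eff_dom[OF assms(4) ymin[OF that]] .
  have ybD: "ybar (k + 1) \<in> eff_dom g" if "k \<le> N" for k
    using that
  proof (induction k)
    case 0
    then show ?case using init by simp
  next
    case (Suc k)
    then have "(1 - 2 / (real (Suc k) + 1)) *\<^sub>R ybar (Suc k) + (2 / (real (Suc k) + 1)) *\<^sub>R ys (Suc k + 1)
        \<in> eff_dom g"
      using ysD[of "Suc k"] by (intro convexD[OF convex_on_imp_convex[OF cvx]]) auto
    then show ?case using ybar[of "Suc k"] Suc.prems by simp
  qed
  have step_x: "real t *\<^sub>R (Df (xhat t) + transpose A *v yhat t) = K *\<^sub>R (xs t - xs (t + 1))"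
    if t: "t \<in> {1..N}" for t
  proof -
    let ?c = "xs t - (real t / K) *\<^sub>R (Df (xhat t) + transpose A *v yhat t)"
    have "\<not> (norm (?c - ?c))\<^sup>2 < (norm (xs (t + 1) - ?c))\<^sup>2"
      using xmin[OF t] unfolding is_arg_min_def by blast
    then have "xs (t + 1) = ?c" by simp
    then show ?thesis using K0 by simp
  qed
  have bound: "reference_gap f A h x y (xbar (N + 1)) (ybar (N + 1))
      \<le> 2 * Lf / (real N * (real N + 1)) * (norm (x - xs 1))\<^sup>2
           + 1 / (real N + 1) * (M\<^sup>2 * (norm (x - xs 1))\<^sup>2 + (norm (y - ys 1))\<^sup>2)"
    if y: "y \<in> eff_dom g" for x y
  proof -
    define \<Phi> where "\<Phi> k = real k * (real k + 1) / 2 * reference_gap f A h x y (xbar (k + 1)) (ybar (k + 1))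
      + distance_potential K (real N) A x y (xs (k + 1)) (ys (k + 1)) (real k *\<^sub>R (ys (k + 1) - ys k))" for k
    have "\<Phi> (Suc k) \<le> \<Phi> k" if k: "Suc k \<le> N" for k
    proof -
      let ?t = "real (Suc k)"
      let ?\<theta> = "2 / (?t + 1)"
      let ?S' = "?t * (?t + 1) / 2" and ?S = "?t * (?t - 1) / 2"
      have t: "Suc k \<in> {1..N}" using k by simp
      have \<theta>: "0 \<le> ?\<theta>" "?\<theta> \<le> 1" by auto
      have S\<theta>: "?S' * (1 - ?\<theta>) = ?S" "?S' * ?\<theta> = ?t" by (simp_all add: field_simps)
      have S\<theta>2: "?S' * (Lf / 2 * ?\<theta>\<^sup>2) \<le> Lf"
      proof -
        have "a * (Lf / 2 * b\<^sup>2) = (a * b) * b * (Lf / 2)" for a b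
          by (simp add: power2_eq_square)
        then have "?S' * (Lf / 2 * ?\<theta>\<^sup>2) = (?S' * ?\<theta>) * ?\<theta> * (Lf / 2)" .
        also have "\<dots> = (?t * ?\<theta>) * (Lf / 2)" by (simp only: S\<theta>)
        also have "\<dots> \<le> 2 * (Lf / 2)" using L0 by (intro mult_right_mono) (auto simp: divide_simps)
        finally show ?thesis by simp
      qed
      have distr2: "s * ((1 - e) * a + e * b) = (s * (1 - e)) * a + (s * e) * b"
        and distr3: "s * ((1 - e) * a + e * b + l * n) = (s * (1 - e)) * a + (s * e) * b + (s * l) * n"
        for s e a b l n :: real
        by (simp_all add: algebra_simps)
      have F: "?S' * f (xbar (Suc k + 1)) \<le> ?S * f (xbar (Suc k))
          + ?t * (f x + Df (xhat (Suc k)) \<bullet> (xs (Suc k + 1) - x))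
          + Lf * (norm (xs (Suc k + 1) - xs (Suc k)))\<^sup>2"
      proof -
        have "?S' * f (xbar (Suc k + 1)) \<le> ?S' * ((1 - ?\<theta>) * f (xbar (Suc k))
          + ?\<theta> * (f x + Df (xhat (Suc k)) \<bullet> (xs (Suc k + 1) - x))
          + Lf / 2 * ?\<theta>\<^sup>2 * (norm (xs (Suc k + 1) - xs (Suc k)))\<^sup>2)"
          by (intro mult_left_mono
              accelerated_gradient_step[OF assms(1-3) \<theta> xhat[OF t] xbar[OF t]]) auto
        also have "\<dots> = ?S * f (xbar (Suc k))
          + ?t * (f x + Df (xhat (Suc k)) \<bullet> (xs (Suc k + 1) - x))
          + ?S' * (Lf / 2 * ?\<theta>\<^sup>2) * (norm (xs (Suc k + 1) - xs (Suc k)))\<^sup>2"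
          by (simp only: distr3 S\<theta>)
        also have "\<dots> \<le> ?S * f (xbar (Suc k))
          + ?t * (f x + Df (xhat (Suc k)) \<bullet> (xs (Suc k + 1) - x))
          + Lf * (norm (xs (Suc k + 1) - xs (Suc k)))\<^sup>2"
          by (intro add_left_mono mult_right_mono S\<theta>2) auto
        finally show ?thesis .
      qed
      have H: "?S' * h (ybar (Suc k + 1)) \<le> ?S * h (ybar (Suc k)) + ?t * h (ys (Suc k + 1))"
      proof -
        have "?S' * h (ybar (Suc k + 1)) \<le> ?S' * ((1 - ?\<theta>) * h (ybar (Suc k)) + ?\<theta> * h (ys (Suc k + 1)))"
          unfolding ybar[OF t] using \<theta> ybD[of k] ysD[OF t] k
          by (intro mult_left_mono convex_onD[OF cvx]) auto
        then show ?thesis by (simp only: distr2 S\<theta>)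
      qed
      have Q: "?t * (h (ys (Suc k + 1)) - h y)
          \<le> (real N *\<^sub>R (ys (Suc k) - ys (Suc k + 1)) + ?t *\<^sub>R (A *v xs (Suc k + 1))) \<bullet> (ys (Suc k + 1) - y)"
      proof -
        have "?t * (h (ys (Suc k + 1)) - h y) \<le> ?t * (1 / (?t / real N) *
            ((ys (Suc k) + (?t / real N) *\<^sub>R (A *v xs (Suc k + 1)) - ys (Suc k + 1)) \<bullet> (ys (Suc k + 1) - y)))"
          unfolding h_def using N0
          by (intro mult_left_mono prox_variational_inequality[OF assms(4,6) _ ymin[OF t] y]) auto
        also have "\<dots> = real N * ((ys (Suc k) + (?t / real N) *\<^sub>R (A *v xs (Suc k + 1)) - ys (Suc k + 1))
            \<bullet> (ys (Suc k + 1) - y))"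
          by simp
        also have "\<dots> = (real N *\<^sub>R (ys (Suc k) + (?t / real N) *\<^sub>R (A *v xs (Suc k + 1)) - ys (Suc k + 1)))
            \<bullet> (ys (Suc k + 1) - y)"
          by simp
        also have "real N *\<^sub>R (ys (Suc k) + (?t / real N) *\<^sub>R (A *v xs (Suc k + 1)) - ys (Suc k + 1))
            = real N *\<^sub>R (ys (Suc k) - ys (Suc k + 1)) + ?t *\<^sub>R (A *v xs (Suc k + 1))"
          using N0 by (simp add: scaleR_add_right scaleR_diff_right del: of_nat_Suc)
        finally show ?thesis .
      qed
      have r: "?t *\<^sub>R yhat (Suc k) = ?t *\<^sub>R ys (Suc k) + real k *\<^sub>R (ys (Suc k) - ys k)"
        \<comment> \<open>For \<open>k = 0\<close> the value \<open>ys 0\<close> is arbitrary, but its coefficient vanishes.\<close>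
      proof (cases k)
        case 0
        then show ?thesis using init by simp
      next
        case (Suc j)
        then show ?thesis using yhat[of k] k by (simp add: scaleR_add_right)
      qed
      have Sk: "?S = real k * (real k + 1) / 2" "?S' = ?S + ?t" by (simp_all add: field_simps)
      have "?t \<le> real N" using k by simp
      from potential_step[OF N0 _ this L0 KM F step_x[OF t] H Q r
          averaging_step_rescaled[OF xbar[OF t]] averaging_step_rescaled[OF ybar[OF t]] Sk(2)]
      show ?thesis unfolding \<Phi>_def Sk(1) by simp
    qed
    then have "\<Phi> k \<le> \<Phi> 0" if "k \<le> N" for k
      using that by (induction k) (auto intro: order_trans)
    then have "\<Phi> N \<le> \<Phi> 0" by simp
    also have "\<Phi> 0 = K / 2 * (norm (x - xs 1))\<^sup>2 + real N / 2 * (norm (y - ys 1))\<^sup>2"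
      by (simp add: \<Phi>_def distance_potential_def norm_minus_commute)
    finally have *: "real N * (real N + 1) / 2 * reference_gap f A h x y (xbar (N + 1)) (ybar (N + 1))
        \<le> K / 2 * (norm (x - xs 1))\<^sup>2 + real N / 2 * (norm (y - ys 1))\<^sup>2"
      using distance_potential_nonneg[OF N0, of A K x y "xs (N + 1)" "ys (N + 1)" "real N *\<^sub>R (ys (N + 1) - ys N)"] L0
      by (simp add: \<Phi>_def KM)
    have S0: "real N * (real N + 1) / 2 > 0" using N0 by simp
    have "K / 2 * (norm (x - xs 1))\<^sup>2 + real N / 2 * (norm (y - ys 1))\<^sup>2
      = real N * (real N + 1) / 2 * (2 * Lf / (real N * (real N + 1)) * (norm (x - xs 1))\<^sup>2
           + 1 / (real N + 1) * (M\<^sup>2 * (norm (x - xs 1))\<^sup>2 + (norm (y - ys 1))\<^sup>2))"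
      using N0 by (simp add: K_def divide_simps) (simp add: algebra_simps)
    with * show ?thesis using S0 mult_le_cancel_left_pos by metis
  qed
  have "saddle_fun f A g (ergodic_avg N xs) y - saddle_fun f A g x (ergodic_avg N ys)
      = ereal (reference_gap f A h x y (xbar (N + 1)) (ybar (N + 1)))"
    if y: "y \<in> eff_dom g" for x y
  proof -
    have "g y = ereal (h y)" "g (ybar (N + 1)) = ereal (h (ybar (N + 1)))"
      using proper_fun_eq_ereal_real[OF assms(4)] y ybD[of N] by (auto simp: h_def)
    then show ?thesis
      by (simp add: saddle_fun_def reference_gap_def flip: ex ey)
  qed
  with bound ex ey show ?thesis unfolding M_def by auto
qed

end
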